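(* Let $0<a<b$ and let $N\ge1$ be an integer. Then there exist $\omega>0$ and $k\in[a,b)$ such that the function $$\rho(r)=\begin{cases}a,& r\in[a,k],\\[2pt] \frac12\left(\left(a^2+\frac{\omega^2}{a^2}\right)\frac{r^2}{k^2}+\left(a^2+\frac{\omega^2}{a^2}\right)\frac{k^2}{r^2}+2\left(a^2-\frac{\omega^2}{a^2}\right)\right)^{1/2},& r\in(k,b],\end{cases}$$ is a solution of the ODE $$r^2\dot\rho^2+\frac{\omega^2}{\rho^2}-\rho^2=-a^2+\frac{\omega^2}{a^2}\quad\text{on }(a,b)$$ with $\rho(a)=a$, $\rho(b)=b$, and such that the corresponding angular map $\psi$ (that is, the solution of $\dot\psi=\omega/(r\rho^2)$ with $\psi(a)=0$) satisfies $\psi(b)=2\pi N$. Furthermore, $\omega$ and $k\in(a,b)$ are uniquely determined by these requirements. The corresponding angular map is $$\psi(r)=\begin{cases}\frac{\omega}{a^2}\ln\left(\frac ra\right),& r\in[a,k],\\[2pt] \frac{\omega}{a^2}\ln\left(\frac ka\right)+\arctan\left(\frac1{2\omega}\left[\left(a^2+\frac{\omega^2}{a^2}\right)\frac{r^2}{k^2}+a^2-\frac{\omega^2}{a^2}\right]\right)-\arctan\left(\frac{a^2}{\omega}\right),& r\in(k,b].\end{cases}$$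
   Context: A dot denotes $d/dr$. The pair $(\rho,\psi)$ represents the rotationally symmetric map $u(r,\theta)=\rho(r)(\cos(\theta+\psi(r)),\sin(\theta+\psi(r)))$ on the annulus $A=\{x\in\mathbb{R}^2:a<|x|<b\}$ (polar coordinates). The ODE system for $(\rho,\psi)$ is the reduction of the Energy-Momentum equations $\mathrm{div}\left(\frac12|\nabla u|^2\mathbf{1}-\nabla u^T\nabla u\right)=0$ in $A$, $u=\mathrm{id}$ on $\partial A$, for maps which twist the outer boundary $N$ times relative to the inner one. *)

theory Defs
  imports "HOL-Analysis.Analysis"
begin

text \<open>The factor \<open>1/2\<close> multiplies the square root (so \<open>\<rho>\<^sup>2\<close> carries a factor
  \<open>1/4\<close>); this makes the two pieces agree at \<open>r = k\<close>, with common value \<open>a\<close>.\<close>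

definition rho_profile :: "real \<Rightarrow> real \<Rightarrow> real \<Rightarrow> real \<Rightarrow> real" where
  "rho_profile a \<omega> k r =
     (if r \<le> k then a
      else 1/2 * sqrt ((a\<^sup>2 + \<omega>\<^sup>2 / a\<^sup>2) * (r\<^sup>2 / k\<^sup>2) + (a\<^sup>2 + \<omega>\<^sup>2 / a\<^sup>2) * (k\<^sup>2 / r\<^sup>2)
                       + 2 * (a\<^sup>2 - \<omega>\<^sup>2 / a\<^sup>2)))"

definition psi_profile :: "real \<Rightarrow> real \<Rightarrow> real \<Rightarrow> real \<Rightarrow> real" where
  "psi_profile a \<omega> k r =
     (if r \<le> k then \<omega> / a\<^sup>2 * ln (r / a)
      else \<omega> / a\<^sup>2 * ln (k / a)
           + arctan (1 / (2 * \<omega>) * ((a\<^sup>2 + \<omega>\<^sup>2 / a\<^sup>2) * (r\<^sup>2 / k\<^sup>2) + a\<^sup>2 - \<omega>\<^sup>2 / a\<^sup>2))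
           - arctan (a\<^sup>2 / \<omega>))"

text \<open>Solutions are classical: \<open>C\<^sup>1\<close> on the open interval and continuous up to the boundary,
  where the boundary values are imposed. No second derivative is asked for, since the profile
  above is not twice differentiable at \<open>r = k\<close>. The condition \<open>\<rho> r \<noteq> 0\<close> only makes the
  quotient \<open>\<omega>\<^sup>2 / \<rho>\<^sup>2\<close> meaningful.\<close>

definition solves_rho_ode :: "real \<Rightarrow> real \<Rightarrow> real \<Rightarrow> (real \<Rightarrow> real) \<Rightarrow> bool" where
  "solves_rho_ode a b \<omega> \<rho> \<longleftrightarrow>
     continuous_on {a..b} \<rho> \<and> \<rho> C1_differentiable_on {a<..<b} \<and>
     (\<forall>r\<in>{a<..<b}. \<rho> r \<noteq> 0 \<and>
        r\<^sup>2 * (deriv \<rho> r)\<^sup>2 + \<omega>\<^sup>2 / (\<rho> r)\<^sup>2 - (\<rho> r)\<^sup>2 = - a\<^sup>2 + \<omega>\<^sup>2 / a\<^sup>2)"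

definition angular_map :: "real \<Rightarrow> real \<Rightarrow> real \<Rightarrow> (real \<Rightarrow> real) \<Rightarrow> (real \<Rightarrow> real) \<Rightarrow> bool" where
  "angular_map a b \<omega> \<rho> \<psi> \<longleftrightarrow>
     continuous_on {a..b} \<psi> \<and> \<psi> a = 0 \<and>
     (\<forall>r\<in>{a<..<b}. (\<psi> has_real_derivative \<omega> / (r * (\<rho> r)\<^sup>2)) (at r))"

definition twist_solution :: "real \<Rightarrow> real \<Rightarrow> int \<Rightarrow> real \<Rightarrow> (real \<Rightarrow> real) \<Rightarrow> bool" where
  "twist_solution a b N \<omega> \<rho> \<longleftrightarrow>
     solves_rho_ode a b \<omega> \<rho> \<and> \<rho> a = a \<and> \<rho> b = b \<and>
     (\<exists>\<psi>. angular_map a b \<omega> \<rho> \<psi> \<and> \<psi> b = 2 * pi * of_int N)"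

end

theory Submission
  imports Defs
begin

text \<open>Put \<open>s = \<omega> / a\<^sup>2\<close> and \<open>u = (b\<^sup>2 - k\<^sup>2) / (b\<^sup>2 + k\<^sup>2)\<close>. Then
  \<open>\<psi> b = s * ln (k / a) + arctan (s * u)\<close>, while \<open>\<rho> b = b\<close> is equivalent to
  \<open>u\<^sup>2 * (b\<^sup>2 + a\<^sup>2 * s\<^sup>2) = b\<^sup>2 - a\<^sup>2\<close>. Along this curve \<open>u\<close> decreases in \<open>s\<close>, so \<open>k\<close> increases,
  and \<open>s * u\<close> increases as well; hence \<open>\<psi> b\<close> is strictly increasing in \<open>s\<close> as long as \<open>k \<ge> a\<close>,
  which gives uniqueness. As \<open>\<psi> b\<close> vanishes for \<open>s = 0\<close> and tends to infinity
  with \<open>s\<close>, it attains the value \<open>2 * pi * N\<close>; since the arctangent contributes less than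
  \<open>pi / 2\<close>, the corresponding \<open>k\<close> exceeds \<open>a\<close>.\<close>

section \<open>Differentiability across an interface point\<close>

text \<open>The difference quotient at \<open>k\<close> splits along the same case distinction, and
  each branch tends to \<open>D\<close>; \<open>f k = g k\<close> makes the base value common to
  both.\<close>

lemma has_real_derivative_glue:
  fixes f g :: "real \<Rightarrow> real"
  assumes "(f has_real_derivative D) (at k)" "(g has_real_derivative D) (at k)" "f k = g k"
  shows "((\<lambda>x. if x \<le> k then f x else g x) has_real_derivative D) (at k)"
proof -
  have "((\<lambda>y. if y \<le> k then (f y - f k) / (y - k) else (g y - g k) / (y - k)) \<longlongrightarrow> D) (at k)"
    using assms(1,2) unfolding has_field_derivative_iff
    by (intro filterlim_If) (auto intro: tendsto_mono[rotated])
  then show ?thesis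
    unfolding has_field_derivative_iff
    by (rule Lim_transform_eventually) (auto simp: assms(3))
qed

text \<open>Only the origin is delicate: there \<open>0\<close> and \<open>x\<^sup>2\<close> share
  value and slope. This is the source of the \<open>C\<^sup>1\<close> regularity at
  \<open>r = k\<close>.\<close>

lemma has_real_derivative_max_0_power2:
  "((\<lambda>x::real. (max 0 x)\<^sup>2) has_real_derivative 2 * max 0 x) (at x)"
proof (cases x "0::real" rule: linorder_cases)
  case less
  show ?thesis
    by (rule has_field_derivative_transform_within_open[of "\<lambda>_. 0" _ _ "{..<0}"])
       (use less in auto)
next
  case equal
  have "((\<lambda>x::real. if x \<le> 0 then 0 else x\<^sup>2) has_real_derivative 0) (at 0)"
    by (rule has_real_derivative_glue) (auto intro!: derivative_eq_intros)
  moreover have "(\<lambda>x::real. if x \<le> 0 then 0 else x\<^sup>2) = (\<lambda>x. (max 0 x)\<^sup>2)"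
    by (auto simp: max_def)
  ultimately show ?thesis
    using equal by simp
next
  case greater
  show ?thesis
    by (rule has_field_derivative_transform_within_open[of "\<lambda>x. x\<^sup>2" _ _ "{0<..}"])
       (use greater in \<open>auto intro!: derivative_eq_intros\<close>)
qed

subsection \<open>The radial profile\<close>

text \<open>Truncation at 0 merges the two branches of the profile into one formula, which is \<open>C\<^sup>1\<close>
  across \<open>r = k\<close> because only the square of the truncated term occurs.\<close>

definition rho_excess :: "real \<Rightarrow> real \<Rightarrow> real" where
  "rho_excess k r = max 0 (r / k - k / r)"

text \<open>Writing \<omega> as \<open>a\<^sup>2 * s\<close> lets \<open>(2 * a)\<^sup>2\<close>
  factor out of the radicand, because \<open>(r / k - k / r)\<^sup>2 = r\<^sup>2 / k\<^sup>2 +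
  k\<^sup>2 / r\<^sup>2 - 2\<close>.\<close>

lemma rho_profile_eq:
  assumes "0 < a" "0 < k" "0 < r"
  shows "rho_profile a (a\<^sup>2 * s) k r = a * sqrt (1 + (1 + s\<^sup>2) / 4 * (rho_excess k r)\<^sup>2)"
proof (cases "r \<le> k")
  case True
  then have "r / k \<le> k / r"
    using assms by (simp add: divide_simps mult_mono)
  with True show ?thesis
    by (simp add: rho_profile_def rho_excess_def max_def)
next
  case False
  then have "k / r \<le> r / k"
    using assms by (simp add: divide_simps mult_mono)
  then have ex: "rho_excess k r = r / k - k / r"
    by (simp add: rho_excess_def)
  have "(a\<^sup>2 * s)\<^sup>2 / a\<^sup>2 = a\<^sup>2 * s\<^sup>2"
    using assms by (simp add: power2_eq_square)
  then have "(a\<^sup>2 + (a\<^sup>2 * s)\<^sup>2 / a\<^sup>2) * (r\<^sup>2 / k\<^sup>2) + (a\<^sup>2 + (a\<^sup>2 * s)\<^sup>2 / a\<^sup>2) * (k\<^sup>2 / r\<^sup>2)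
      + 2 * (a\<^sup>2 - (a\<^sup>2 * s)\<^sup>2 / a\<^sup>2)
    = (2 * a)\<^sup>2 * (1 + (1 + s\<^sup>2) / 4 * (rho_excess k r)\<^sup>2)"
    unfolding ex using assms by (simp add: field_simps power2_eq_square)
  then show ?thesis
    using False assms by (simp add: rho_profile_def real_sqrt_mult)
qed

lemma one_le_rho_radicand: "1 \<le> 1 + (1 + s\<^sup>2) / 4 * (w::real)\<^sup>2"
  by simp

lemma rho_profile_power2:
  assumes "0 < a" "0 < k" "0 < r"
  shows "(rho_profile a (a\<^sup>2 * s) k r)\<^sup>2 = a\<^sup>2 * (1 + (1 + s\<^sup>2) / 4 * (rho_excess k r)\<^sup>2)"
  using one_le_rho_radicand[of s "rho_excess k r"]
  by (simp add: rho_profile_eq[OF assms] power_mult_distrib)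

lemma rho_profile_pos:
  assumes "0 < a" "0 < k" "0 < r"
  shows "0 < rho_profile a (a\<^sup>2 * s) k r"
proof -
  have "0 < sqrt (1 + (1 + s\<^sup>2) / 4 * (rho_excess k r)\<^sup>2)"
    using one_le_rho_radicand[of s "rho_excess k r"] by (intro real_sqrt_gt_zero) linarith
  then show ?thesis
    unfolding rho_profile_eq[OF assms] using assms(1) by (rule mult_pos_pos[rotated])
qed

text \<open>The chain-rule derivative of the closed form above. Keeping the truncated excess as a
  factor makes it vanish for \<open>0 < r \<le> k\<close>, so that one formula serves both
  branches.\<close>

definition rho_slope :: "real \<Rightarrow> real \<Rightarrow> real \<Rightarrow> real \<Rightarrow> real" where
  "rho_slope a s k r = a * ((1 + s\<^sup>2) / 4 * (rho_excess k r * (1 / k + k / r\<^sup>2))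
     / sqrt (1 + (1 + s\<^sup>2) / 4 * (rho_excess k r)\<^sup>2))"

lemma has_real_derivative_rho_profile:
  assumes "0 < a" "0 < k" "0 < r"
  shows "(rho_profile a (a\<^sup>2 * s) k has_real_derivative rho_slope a s k r) (at r)"
proof -
  have "((\<lambda>r. r / k - k / r) has_real_derivative 1 / k + k / r\<^sup>2) (at r)"
    using assms by (auto intro!: derivative_eq_intros simp: field_simps power2_eq_square)
  from DERIV_chain2[OF has_real_derivative_max_0_power2 this]
  have 1: "((\<lambda>r. (rho_excess k r)\<^sup>2) has_real_derivative
      2 * rho_excess k r * (1 / k + k / r\<^sup>2)) (at r)"
    unfolding rho_excess_def .
  have pos: "1 + (1 + s\<^sup>2) / 4 * (rho_excess k r)\<^sup>2 > 0"
    using one_le_rho_radicand[of s "rho_excess k r"] by linarith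
  have "((\<lambda>r. 1 + (1 + s\<^sup>2) / 4 * (rho_excess k r)\<^sup>2) has_real_derivative
      (1 + s\<^sup>2) / 4 * (2 * rho_excess k r * (1 / k + k / r\<^sup>2))) (at r)"
    by (rule DERIV_cong[OF DERIV_add[OF DERIV_const DERIV_cmult[OF 1]]]) simp
  then have "((\<lambda>r. a * sqrt (1 + (1 + s\<^sup>2) / 4 * (rho_excess k r)\<^sup>2)) has_real_derivative
      a * (inverse (sqrt (1 + (1 + s\<^sup>2) / 4 * (rho_excess k r)\<^sup>2)) / 2 *
        ((1 + s\<^sup>2) / 4 * (2 * rho_excess k r * (1 / k + k / r\<^sup>2))))) (at r)"
    by (rule DERIV_cmult[OF DERIV_chain2[where g = "\<lambda>r. 1 + (1 + s\<^sup>2) / 4 * (rho_excess k r)\<^sup>2",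
          OF DERIV_real_sqrt[OF pos]]])
  \<comment> \<open>The 2 from differentiating the square cancels the 1/2 from the root; for
    \<open>q = 0\<close> both sides are 0 by the convention on division.\<close>
  moreover have rearrange: "inverse q / 2 * (C * (2 * w * v)) = C * (w * v) / q" for C q v w :: real
    by (cases "q = 0") (simp_all add: field_simps)
  ultimately have D: "((\<lambda>r. a * sqrt (1 + (1 + s\<^sup>2) / 4 * (rho_excess k r)\<^sup>2)) has_real_derivative
      rho_slope a s k r) (at r)"
    unfolding rho_slope_def rearrange by blast
  have "r \<in> {0<..}"
    using assms(3) by simp
  from D open_greaterThan this show ?thesis
    by (rule has_field_derivative_transform_within_open) (simp add: rho_profile_eq[OF assms(1,2)])
qed

text \<open>With \<rho>^2 = \<open>a\<^sup>2 * P\<close> and \<open>c = 1 + s\<^sup>2\<close>,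
  everything reduces to \<open>((P - 1)\<^sup>2 + c * (P - 1) + s\<^sup>2) / P - P = s\<^sup>2 -
  1\<close>.\<close>

lemma rho_profile_ode:
  assumes "0 < a" "0 < k" "0 < r"
  shows "r\<^sup>2 * (rho_slope a s k r)\<^sup>2 + (a\<^sup>2 * s)\<^sup>2 / (rho_profile a (a\<^sup>2 * s) k r)\<^sup>2
      - (rho_profile a (a\<^sup>2 * s) k r)\<^sup>2 = - a\<^sup>2 + (a\<^sup>2 * s)\<^sup>2 / a\<^sup>2"
proof -
  define w where "w = rho_excess k r"
  define c where "c = 1 + s\<^sup>2"
  define P where "P = 1 + c / 4 * w\<^sup>2"
  have P: "P > 0"
    using one_le_rho_radicand[of s w] unfolding P_def c_def by linarith
  \<comment> \<open>This is \<open>(x + 1 / x)\<^sup>2 = (x - 1 / x)\<^sup>2 + 4\<close> for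
    \<open>x = r / k\<close>; the factor \<open>w\<^sup>2\<close> makes both sides vanish where the
    truncation is active.\<close>
  have w: "w\<^sup>2 * (r * (1 / k + k / r\<^sup>2))\<^sup>2 = w\<^sup>2 * (w\<^sup>2 + 4)"
    using assms unfolding w_def rho_excess_def max_def
    by (auto simp: field_simps power2_eq_square)
  have "r\<^sup>2 * (rho_slope a s k r)\<^sup>2
      = a\<^sup>2 * c\<^sup>2 / 16 * (w\<^sup>2 * (r * (1 / k + k / r\<^sup>2))\<^sup>2) / P"
    using P unfolding rho_slope_def c_def[symmetric] w_def[symmetric] P_def[symmetric]
    by (simp add: power_mult_distrib power_divide)
  also have "\<dots> = a\<^sup>2 * ((c * w\<^sup>2)\<^sup>2 + 4 * c * (c * w\<^sup>2)) / (16 * P)"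
    unfolding w by (simp add: field_simps power2_eq_square)
  also have "c * w\<^sup>2 = 4 * (P - 1)"
    by (simp add: P_def)
  finally have 1: "r\<^sup>2 * (rho_slope a s k r)\<^sup>2 = a\<^sup>2 * ((P - 1)\<^sup>2 + c * (P - 1)) / P"
    using P by (simp add: field_simps power2_eq_square)
  have 2: "(rho_profile a (a\<^sup>2 * s) k r)\<^sup>2 = a\<^sup>2 * P"
    using rho_profile_power2[OF assms] by (simp add: P_def c_def w_def)
  show ?thesis
    unfolding 1 2 using P assms(1) by (simp add: c_def field_simps power2_eq_square)
qed

lemma solves_rho_ode_rho_profile:
  assumes "0 < a" "0 < k"
  shows "solves_rho_ode a b (a\<^sup>2 * s) (rho_profile a (a\<^sup>2 * s) k)"
proof -
  note D = has_real_derivative_rho_profile[OF assms, of _ s]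
  have "continuous_on {a..b} (rho_profile a (a\<^sup>2 * s) k)"
    using assms(1) by (intro continuous_at_imp_continuous_on ballI DERIV_isCont[OF D]) auto
  moreover have "continuous_on {a<..<b} (rho_slope a s k)"
  proof -
    have "1 + (1 + s\<^sup>2) / 4 * w\<^sup>2 \<noteq> 0" for w :: real
      using one_le_rho_radicand[of s w] by linarith
    then show ?thesis
      unfolding rho_slope_def rho_excess_def using assms
      by (intro continuous_intros) auto
  qed
  then have "rho_profile a (a\<^sup>2 * s) k C1_differentiable_on {a<..<b}"
    unfolding C1_differentiable_on_def has_real_derivative_iff_has_vector_derivative[symmetric]
    using D assms(1) by (intro exI[of _ "rho_slope a s k"]) auto
  moreover have "rho_profile a (a\<^sup>2 * s) k r \<noteq> 0" if "0 < r" for r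
    using rho_profile_pos[OF assms that, of s] by simp
  moreover have "deriv (rho_profile a (a\<^sup>2 * s) k) r = rho_slope a s k r" if "0 < r" for r
    using D[OF that] by (rule DERIV_imp_deriv)
  ultimately show ?thesis
    unfolding solves_rho_ode_def using rho_profile_ode[OF assms] assms(1) by simp
qed

text \<open>The quotient of \<open>b\<^sup>2 - k\<^sup>2\<close> by
  \<open>b\<^sup>2 + k\<^sup>2\<close> is also what enters the arctangent at \<open>r = b\<close>,
  so both outer boundary conditions share this variable.\<close>

lemma rho_profile_outer_boundary_iff:
  assumes "0 < a" "0 < k" "k < b"
  shows "rho_profile a (a\<^sup>2 * s) k b = b \<longleftrightarrow>
    ((b\<^sup>2 - k\<^sup>2) / (b\<^sup>2 + k\<^sup>2))\<^sup>2 * (b\<^sup>2 + a\<^sup>2 * s\<^sup>2) = b\<^sup>2 - a\<^sup>2"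
proof -
  have b: "0 < b" using assms by simp
  have "k / b \<le> b / k"
    using assms by (simp add: divide_simps mult_mono)
  then have ex: "rho_excess k b = (b\<^sup>2 - k\<^sup>2) / (b * k)"
    using assms b by (simp add: rho_excess_def field_simps power2_eq_square)
  define d e where "d = b\<^sup>2 - k\<^sup>2" and "e = b\<^sup>2 + k\<^sup>2"
  have e: "e > 0" and de: "e\<^sup>2 = d\<^sup>2 + 4 * (b * k)\<^sup>2"
    using assms b unfolding d_def e_def by (simp_all add: add_pos_pos power2_eq_square algebra_simps)
  have "rho_profile a (a\<^sup>2 * s) k b = b \<longleftrightarrow> (rho_profile a (a\<^sup>2 * s) k b)\<^sup>2 = b\<^sup>2"
    using rho_profile_pos[OF assms(1,2) b, of s] b by (simp add: power2_eq_iff_nonneg)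
  also have "\<dots> \<longleftrightarrow> a\<^sup>2 * (1 + (1 + s\<^sup>2) / 4 * (d\<^sup>2 / (b * k)\<^sup>2)) = b\<^sup>2"
    unfolding rho_profile_power2[OF assms(1,2) b] ex d_def power_divide ..
  also have "\<dots> \<longleftrightarrow> a\<^sup>2 * (1 + s\<^sup>2) * d\<^sup>2 = (b\<^sup>2 - a\<^sup>2) * (4 * (b * k)\<^sup>2)"
    using assms b by (simp add: field_simps)
  \<comment> \<open>Add \<open>(b\<^sup>2 - a\<^sup>2) * d\<^sup>2\<close> to both sides and use
    \<open>de\<close>.\<close>
  also have "\<dots> \<longleftrightarrow> d\<^sup>2 * (b\<^sup>2 + a\<^sup>2 * s\<^sup>2) = (b\<^sup>2 - a\<^sup>2) * e\<^sup>2"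
    unfolding de by (auto simp: algebra_simps)
  also have "\<dots> \<longleftrightarrow> (d / e)\<^sup>2 * (b\<^sup>2 + a\<^sup>2 * s\<^sup>2) = b\<^sup>2 - a\<^sup>2"
    using e by (simp add: field_simps)
  finally show ?thesis
    unfolding d_def e_def .
qed

subsection \<open>The angular map\<close>

text \<open>Tangent addition formula, with \<open>X\<close> standing for
  \<open>(r / k)\<^sup>2\<close>. Since \<open>u < 1\<close>,
  \<open>arctan (s * u) < arctan s = pi / 2 - arctan (1 / s)\<close>, so the sum of the two
  arctangents stays in the principal range.\<close>

lemma arctan_diff_eq:
  assumes "0 < s" "0 < X"
  shows "arctan (((1 + s\<^sup>2) * X + 1 - s\<^sup>2) / (2 * s)) - arctan (1 / s) =
    arctan (s * ((X - 1) / (X + 1)))"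
proof -
  define u where "u = (X - 1) / (X + 1)"
  have u1: "u < 1"
    using assms by (simp add: u_def)
  have "- (pi / 2) < arctan (1 / s) + arctan (s * u)"
  proof -
    have "0 < arctan (1 / s)"
      using assms by (simp add: zero_less_arctan_iff)
    then show ?thesis
      using arctan_lbound[of "s * u"] by linarith
  qed
  moreover have lt: "arctan (1 / s) + arctan (s * u) < pi / 2"
  proof -
    have "arctan (s * u) < arctan s"
      using u1 assms by (simp add: arctan_less_iff)
    then show ?thesis
      using arctan_inverse[of s] assms by (simp add: inverse_eq_divide)
  qed
  moreover have "tan (arctan (1 / s) + arctan (s * u)) = ((1 + s\<^sup>2) * X + 1 - s\<^sup>2) / (2 * s)"
  proof -
    have "cos (arctan (1 / s) + arctan (s * u)) > 0"
      using calculation by (intro cos_gt_zero_pi) auto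
    then have "tan (arctan (1 / s) + arctan (s * u)) = (1 / s + s * u) / (1 - 1 / s * (s * u))"
      by (subst tan_add) (auto simp: tan_arctan)
    also have "\<dots> = (1 / s + s * u) / (1 - u)"
      using assms by simp
    also have "1 - u = 2 / (X + 1)"
      using assms by (simp add: u_def field_simps)
    also have "1 / s + s * u = ((1 + s\<^sup>2) * X + 1 - s\<^sup>2) / (s * (X + 1))"
      using assms unfolding u_def by (simp add: divide_simps) (simp add: algebra_simps power2_eq_square)
    also have "\<dots> / (2 / (X + 1)) = ((1 + s\<^sup>2) * X + 1 - s\<^sup>2) / (2 * s)"
      using assms by (simp add: divide_simps)
    finally show ?thesis .
  qed
  ultimately have "arctan (((1 + s\<^sup>2) * X + 1 - s\<^sup>2) / (2 * s)) = arctan (1 / s) + arctan (s * u)"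
    by (intro arctan_unique)
  then show ?thesis
    by (simp add: u_def)
qed

text \<open>In this form the branches visibly agree at \<open>r = k\<close>, where the arctangent
  term is 0.\<close>

lemma psi_profile_eq:
  assumes "0 < a" "0 < k" "0 < r" "0 < s"
  shows "psi_profile a (a\<^sup>2 * s) k r = (if r \<le> k then s * ln (r / a)
     else s * ln (k / a) + arctan (s * ((r\<^sup>2 - k\<^sup>2) / (r\<^sup>2 + k\<^sup>2))))"
proof -
  have "(a\<^sup>2 * s)\<^sup>2 / a\<^sup>2 = a\<^sup>2 * s\<^sup>2"
    using assms by (simp add: power2_eq_square)
  then have "(a\<^sup>2 + (a\<^sup>2 * s)\<^sup>2 / a\<^sup>2) * (r\<^sup>2 / k\<^sup>2) + a\<^sup>2 - (a\<^sup>2 * s)\<^sup>2 / a\<^sup>2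
    = a\<^sup>2 * ((1 + s\<^sup>2) * (r\<^sup>2 / k\<^sup>2) + 1 - s\<^sup>2)"
    by (simp add: algebra_simps add_divide_distrib)
  then have 1: "1 / (2 * (a\<^sup>2 * s)) * ((a\<^sup>2 + (a\<^sup>2 * s)\<^sup>2 / a\<^sup>2) * (r\<^sup>2 / k\<^sup>2) + a\<^sup>2 - (a\<^sup>2 * s)\<^sup>2 / a\<^sup>2)
    = ((1 + s\<^sup>2) * (r\<^sup>2 / k\<^sup>2) + 1 - s\<^sup>2) / (2 * s)"
    using assms by simp
  have 2: "(r\<^sup>2 / k\<^sup>2 - 1) / (r\<^sup>2 / k\<^sup>2 + 1) = (r\<^sup>2 - k\<^sup>2) / (r\<^sup>2 + k\<^sup>2)"
  proof -
    have "r\<^sup>2 / k\<^sup>2 - 1 = (r\<^sup>2 - k\<^sup>2) / k\<^sup>2" "r\<^sup>2 / k\<^sup>2 + 1 = (r\<^sup>2 + k\<^sup>2) / k\<^sup>2"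
      using assms by (simp_all add: field_simps)
    then show ?thesis
      using assms by simp
  qed
  show ?thesis
    unfolding psi_profile_def 1
    using arctan_diff_eq[of s "r\<^sup>2 / k\<^sup>2"] assms by (simp add: 2)
qed

lemma has_real_derivative_psi_profile:
  assumes "0 < a" "0 < k" "0 < r" "0 < s"
  shows "(psi_profile a (a\<^sup>2 * s) k has_real_derivative
    a\<^sup>2 * s / (r * (rho_profile a (a\<^sup>2 * s) k r)\<^sup>2)) (at r)"
proof -
  define f where "f = (\<lambda>r. s * ln (r / a))"
  define g where "g = (\<lambda>r. s * ln (k / a) + arctan (s * ((r\<^sup>2 - k\<^sup>2) / (r\<^sup>2 + k\<^sup>2))))"
  define D where "D = a\<^sup>2 * s / (r * (rho_profile a (a\<^sup>2 * s) k r)\<^sup>2)"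
  have D: "D = s / (r * (1 + (1 + s\<^sup>2) / 4 * (rho_excess k r)\<^sup>2))"
    using assms by (simp add: D_def rho_profile_power2)
  have f: "(f has_real_derivative D) (at r)" if "r \<le> k"
  proof -
    have "r / k \<le> k / r"
      using assms that by (simp add: divide_simps mult_mono)
    then have "D = s / r"
      by (simp add: D rho_excess_def max_def)
    then show ?thesis
      unfolding f_def using assms by (auto intro!: derivative_eq_intros)
  qed
  have g: "(g has_real_derivative D) (at r)" if "k \<le> r"
  proof -
    have "k / r \<le> r / k"
      using assms that by (simp add: divide_simps mult_mono)
    then have ex: "rho_excess k r = (r\<^sup>2 - k\<^sup>2) / (r * k)"
      using assms by (simp add: rho_excess_def field_simps power2_eq_square)
    \<comment> \<open>The aim is to bring \<open>D\<close> into the shape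
      \<open>s * v' / (1 + (s * v)\<^sup>2)\<close> with \<open>v = d / e\<close>, the derivative of
      \<open>arctan (s * v)\<close>.\<close>
    define d e where "d = r\<^sup>2 - k\<^sup>2" and "e = r\<^sup>2 + k\<^sup>2"
    have e: "e > 0" and de: "e\<^sup>2 = d\<^sup>2 + 4 * (r * k)\<^sup>2"
      using assms unfolding d_def e_def
      by (simp_all add: add_pos_pos power2_eq_square algebra_simps)
    have pos: "e\<^sup>2 + s\<^sup>2 * d\<^sup>2 > 0"
      using e by (intro add_pos_nonneg) auto
    have frac: "s / (r * (Q / (4 * (r * k)\<^sup>2))) = s * (4 * r * k\<^sup>2) / Q" if "Q > 0" for Q
      using that assms by (simp add: field_simps power2_eq_square)
    have "D = s / (r * ((4 * (r * k)\<^sup>2 + (1 + s\<^sup>2) * d\<^sup>2) / (4 * (r * k)\<^sup>2)))"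
      unfolding D ex d_def[symmetric] using assms by (simp add: field_simps)
    also have "4 * (r * k)\<^sup>2 + (1 + s\<^sup>2) * d\<^sup>2 = e\<^sup>2 + s\<^sup>2 * d\<^sup>2"
      unfolding de by (simp add: algebra_simps)
    also have "s / (r * ((e\<^sup>2 + s\<^sup>2 * d\<^sup>2) / (4 * (r * k)\<^sup>2))) = s * (4 * r * k\<^sup>2) / (e\<^sup>2 + s\<^sup>2 * d\<^sup>2)"
      using pos by (rule frac)
    also have "\<dots> = s * (4 * r * k\<^sup>2 / e\<^sup>2) / (1 + (s * (d / e))\<^sup>2)"
      using e pos by (simp add: field_simps)
    finally have D': "D = s * (4 * r * k\<^sup>2 / e\<^sup>2) / (1 + (s * (d / e))\<^sup>2)" .
    have "((\<lambda>r. (r\<^sup>2 - k\<^sup>2) / (r\<^sup>2 + k\<^sup>2)) has_real_derivative 4 * r * k\<^sup>2 / e\<^sup>2) (at r)"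
      using e unfolding e_def
      by (auto intro!: derivative_eq_intros simp: power2_eq_square algebra_simps)
    from DERIV_add[OF DERIV_const DERIV_chain2[OF DERIV_arctan DERIV_cmult[OF this]]]
    show ?thesis
      unfolding g_def D' d_def e_def
      by (rule DERIV_cong) (simp add: divide_inverse)
  qed
  \<comment> \<open>Both \<open>f\<close> and \<open>g\<close> are available at \<open>r = k\<close>
    itself, which is what the gluing needs.\<close>
  have "((\<lambda>r. if r \<le> k then f r else g r) has_real_derivative D) (at r)"
  proof (cases r k rule: linorder_cases)
    case less
    show ?thesis
      by (rule has_field_derivative_transform_within_open[of f _ _ "{..<k}"])
         (use less f in auto)
  next
    case equal
    have "f k = g k"
      by (simp add: f_def g_def)
    with f g equal show ?thesis
      by (auto intro: has_real_derivative_glue)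
  next
    case greater
    show ?thesis
      by (rule has_field_derivative_transform_within_open[of g _ _ "{k<..}"])
         (use greater g in auto)
  qed
  then show ?thesis
    unfolding D_def[symmetric]
    by (rule has_field_derivative_transform_within_open[where S = "{0<..}"])
       (use assms in \<open>auto simp: psi_profile_eq f_def g_def\<close>)
qed

lemma angular_map_psi_profile:
  assumes "0 < a" "a \<le> k" "0 < s"
  shows "angular_map a b (a\<^sup>2 * s) (rho_profile a (a\<^sup>2 * s) k) (psi_profile a (a\<^sup>2 * s) k)"
proof -
  have D: "(psi_profile a (a\<^sup>2 * s) k has_real_derivative
    a\<^sup>2 * s / (r * (rho_profile a (a\<^sup>2 * s) k r)\<^sup>2)) (at r)" if "a \<le> r" for r
    using assms that by (intro has_real_derivative_psi_profile) auto
  then have "continuous_on {a..b} (psi_profile a (a\<^sup>2 * s) k)"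
    by (intro continuous_at_imp_continuous_on) (fastforce intro: DERIV_isCont)
  moreover have "psi_profile a (a\<^sup>2 * s) k a = 0"
    using assms by (simp add: psi_profile_def)
  ultimately show ?thesis
    using D by (simp add: angular_map_def)
qed

text \<open>The difference has zero derivative inside and vanishes at \<open>a\<close>. Hence the
  existentially quantified angular map in \<open>twist_solution\<close> can be replaced by
  \<open>psi_profile\<close>.\<close>

lemma angular_map_unique:
  assumes "a < b" "angular_map a b \<omega> \<rho> \<psi>" "angular_map a b \<omega> \<rho> \<phi>" "r \<in> {a..b}"
  shows "\<psi> r = \<phi> r"
proof -
  have "(\<lambda>x. \<psi> x - \<phi> x) r = (\<lambda>x. \<psi> x - \<phi> x) a"
  proof (rule DERIV_isconst2[OF assms(1)])
    show "continuous_on {a..b} (\<lambda>x. \<psi> x - \<phi> x)"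
      using assms(2,3) by (auto simp: angular_map_def intro: continuous_intros)
    show "((\<lambda>x. \<psi> x - \<phi> x) has_real_derivative 0) (at x)" if "a < x" "x < b" for x
      using assms(2,3) that unfolding angular_map_def
      by (auto intro!: derivative_eq_intros)
  qed (use assms(4) in auto)
  then show ?thesis
    using assms(2,3) by (simp add: angular_map_def)
qed

subsection \<open>Matching the boundary values\<close>

text \<open>The ODE and the value at \<open>a\<close> hold for all these parameters, so only the two
  conditions at \<open>b\<close> remain, as scalar equations in \<open>s\<close> and
  \<open>k\<close>.\<close>

lemma twist_solution_rho_profile_iff:
  assumes "0 < a" "a \<le> k" "k < b" "0 < s"
  defines "u \<equiv> (b\<^sup>2 - k\<^sup>2) / (b\<^sup>2 + k\<^sup>2)"
  shows "twist_solution a b N (a\<^sup>2 * s) (rho_profile a (a\<^sup>2 * s) k) \<longleftrightarrow>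
    u\<^sup>2 * (b\<^sup>2 + a\<^sup>2 * s\<^sup>2) = b\<^sup>2 - a\<^sup>2 \<and> s * ln (k / a) + arctan (s * u) = 2 * pi * N"
proof -
  have k: "0 < k" and ab: "a < b"
    using assms by auto
  have psi_b: "psi_profile a (a\<^sup>2 * s) k b = s * ln (k / a) + arctan (s * u)"
    using assms by (simp add: psi_profile_eq)
  have rho_a: "rho_profile a (a\<^sup>2 * s) k a = a"
    using assms by (simp add: rho_profile_def)
  have "(\<exists>\<psi>. angular_map a b (a\<^sup>2 * s) (rho_profile a (a\<^sup>2 * s) k) \<psi> \<and> \<psi> b = 2 * pi * N)
    \<longleftrightarrow> psi_profile a (a\<^sup>2 * s) k b = 2 * pi * N"
  proof
    assume "psi_profile a (a\<^sup>2 * s) k b = 2 * pi * N"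
    then show "\<exists>\<psi>. angular_map a b (a\<^sup>2 * s) (rho_profile a (a\<^sup>2 * s) k) \<psi> \<and> \<psi> b = 2 * pi * N"
      using angular_map_psi_profile[OF assms(1,2,4)] by blast
  next
    assume "\<exists>\<psi>. angular_map a b (a\<^sup>2 * s) (rho_profile a (a\<^sup>2 * s) k) \<psi> \<and> \<psi> b = 2 * pi * N"
    then show "psi_profile a (a\<^sup>2 * s) k b = 2 * pi * N"
      using angular_map_unique[OF ab angular_map_psi_profile[OF assms(1,2,4)], of _ b] ab by auto
  qed
  then show ?thesis
    using solves_rho_ode_rho_profile[OF assms(1) k, of b s]
      rho_profile_outer_boundary_iff[OF assms(1) k assms(3), of s]
    by (simp add: twist_solution_def rho_a psi_b u_def)
qed

section \<open>Monotonicity of the twist angle and uniqueness of the parameters\<close>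

lemma twist_angle_strict_mono:
  fixes a b k k' s s' :: real
  assumes ab: "0 < a" "a < b" and k: "a \<le> k" "k < b" "0 < k'" "k' < b" and s: "0 < s" "s < s'"
  defines "u \<equiv> (b\<^sup>2 - k\<^sup>2) / (b\<^sup>2 + k\<^sup>2)" and "u' \<equiv> (b\<^sup>2 - k'\<^sup>2) / (b\<^sup>2 + k'\<^sup>2)"
  assumes eq: "u\<^sup>2 * (b\<^sup>2 + a\<^sup>2 * s\<^sup>2) = b\<^sup>2 - a\<^sup>2" "u'\<^sup>2 * (b\<^sup>2 + a\<^sup>2 * s'\<^sup>2) = b\<^sup>2 - a\<^sup>2"
  shows "s * ln (k / a) + arctan (s * u) < s' * ln (k' / a) + arctan (s' * u')"
proof -
  have sq: "s\<^sup>2 < s'\<^sup>2"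
    using s by (intro power_strict_mono) auto
  have pos: "b\<^sup>2 + a\<^sup>2 * s\<^sup>2 > 0" "b\<^sup>2 + a\<^sup>2 * s'\<^sup>2 > 0" "b\<^sup>2 - a\<^sup>2 > 0" "b\<^sup>2 > 0" "a\<^sup>2 > 0"
    using ab by (auto intro!: add_pos_nonneg simp: power_strict_mono)
  have kpos: "0 < k"
    using ab k by simp
  have u_pos: "0 < u" "0 < u'"
    using k kpos unfolding u_def u'_def
    by (auto intro!: divide_pos_pos add_pos_pos simp: power_strict_mono)
  have u2: "u\<^sup>2 = (b\<^sup>2 - a\<^sup>2) / (b\<^sup>2 + a\<^sup>2 * s\<^sup>2)" "u'\<^sup>2 = (b\<^sup>2 - a\<^sup>2) / (b\<^sup>2 + a\<^sup>2 * s'\<^sup>2)"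
    using eq pos by (simp_all add: field_simps)
  have "u'\<^sup>2 < u\<^sup>2"
    unfolding u2 using sq pos by (intro divide_strict_left_mono) auto
  then have "u' < u"
    using u_pos by (simp add: power_less_imp_less_base)
  then have "k\<^sup>2 < k'\<^sup>2"
  proof -
    have "0 < b\<^sup>2 + k\<^sup>2" "0 < b\<^sup>2 + k'\<^sup>2"
      using pos by (auto intro: add_pos_nonneg)
    \<comment> \<open>Cross-multiplying cancels all terms except
      \<open>2 * b\<^sup>2 * k\<^sup>2\<close> and
      \<open>2 * b\<^sup>2 * k'\<^sup>2\<close>.\<close>
    with \<open>u' < u\<close> have "b\<^sup>2 * k\<^sup>2 < b\<^sup>2 * k'\<^sup>2"
      unfolding u_def u'_def by (simp add: pos_divide_less_eq pos_less_divide_eq) (simp add: algebra_simps)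
    then show ?thesis
      using pos by simp
  qed
  then have "k < k'"
    using k by (simp add: power_less_imp_less_base)
  \<comment> \<open>Here \<open>a \<le> k\<close> enters: the logarithm is nonnegative, so enlarging
    both factors enlarges the product.\<close>
  then have "s * ln (k / a) \<le> s' * ln (k' / a)"
    using s ab k by (intro mult_mono) (auto simp: divide_right_mono)
  \<comment> \<open>Although \<open>u\<close> decreases, \<open>(s * u)\<^sup>2\<close> is
    \<open>b\<^sup>2 - a\<^sup>2\<close> times \<open>x / (b\<^sup>2 + a\<^sup>2 * x)\<close> at
    \<open>x = s\<^sup>2\<close>, which increases in \<open>x\<close>.\<close>
  moreover have "(s * u)\<^sup>2 < (s' * u')\<^sup>2"
  proof -
    have "s\<^sup>2 / (b\<^sup>2 + a\<^sup>2 * s\<^sup>2) < s'\<^sup>2 / (b\<^sup>2 + a\<^sup>2 * s'\<^sup>2)"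
      using sq pos by (simp add: divide_simps algebra_simps)
    then have "(b\<^sup>2 - a\<^sup>2) * (s\<^sup>2 / (b\<^sup>2 + a\<^sup>2 * s\<^sup>2)) < (b\<^sup>2 - a\<^sup>2) * (s'\<^sup>2 / (b\<^sup>2 + a\<^sup>2 * s'\<^sup>2))"
      using pos by (intro mult_strict_left_mono)
    then show ?thesis
      by (simp add: power_mult_distrib u2 mult.commute)
  qed
  then have "s * u < s' * u'"
    by (rule power_less_imp_less_base) (use s u_pos in simp)
  then have "arctan (s * u) < arctan (s' * u')"
    by (simp only: arctan_less_iff)
  ultimately show ?thesis
    by (rule add_le_less_mono)
qed

text \<open>Strict monotonicity forces \<open>s = s'\<close>; the boundary equation then fixes
  \<open>u\<close> by positivity, and \<open>u\<close> determines \<open>k\<close>.\<close>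

lemma twist_parameters_unique:
  fixes a b k k' s s' T :: real
  assumes ab: "0 < a" "a < b" and k: "a \<le> k" "k < b" "a \<le> k'" "k' < b" and s: "0 < s" "0 < s'"
  defines "u \<equiv> (b\<^sup>2 - k\<^sup>2) / (b\<^sup>2 + k\<^sup>2)" and "u' \<equiv> (b\<^sup>2 - k'\<^sup>2) / (b\<^sup>2 + k'\<^sup>2)"
  assumes eq: "u\<^sup>2 * (b\<^sup>2 + a\<^sup>2 * s\<^sup>2) = b\<^sup>2 - a\<^sup>2" "u'\<^sup>2 * (b\<^sup>2 + a\<^sup>2 * s'\<^sup>2) = b\<^sup>2 - a\<^sup>2"
    and T: "s * ln (k / a) + arctan (s * u) = T" "s' * ln (k' / a) + arctan (s' * u') = T"
  shows "s = s' \<and> k = k'"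
proof -
  have kpos: "0 < k" "0 < k'"
    using ab(1) k(1,3) by linarith+
  note eqs = eq[unfolded u_def u'_def] and Ts = T[unfolded u_def u'_def]
  have ss: "s = s'"
  proof (cases s s' rule: linorder_cases)
    case less
    \<comment> \<open>Rewriting with \<open>Ts\<close> turns the inequality into
      \<open>T < T\<close>.\<close>
    from twist_angle_strict_mono[OF ab k(1,2) kpos(2) k(4) s(1) less eqs] show ?thesis
      unfolding Ts by (rule less_irrefl[THEN notE, rotated])
  next
    case greater
    from twist_angle_strict_mono[OF ab k(3,4) kpos(1) k(2) s(2) greater eqs(2,1)] show ?thesis
      unfolding Ts by (rule less_irrefl[THEN notE, rotated])
  qed
  moreover have "k = k'"
  proof -
    have "0 < b\<^sup>2 + a\<^sup>2 * s'\<^sup>2"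
      using ab by (intro add_pos_nonneg) auto
    then have "u\<^sup>2 = u'\<^sup>2"
      using eq unfolding ss by (metis mult_right_cancel less_irrefl)
    moreover have "0 < u" "0 < u'"
      using k kpos unfolding u_def u'_def
      by (auto intro!: divide_pos_pos add_pos_pos simp: power_strict_mono)
    ultimately have "u = u'"
      by (simp add: power2_eq_iff)
    moreover have "0 < b\<^sup>2 + k\<^sup>2" "0 < b\<^sup>2 + k'\<^sup>2"
      using kpos by (auto intro: add_nonneg_pos)
    ultimately have "b\<^sup>2 * k\<^sup>2 = b\<^sup>2 * k'\<^sup>2"
      unfolding u_def u'_def by (subst (asm) frac_eq_eq) (auto simp: algebra_simps)
    then show ?thesis
      using ab kpos by (simp add: power2_eq_iff)
  qed
  ultimately show ?thesis ..
qed

section \<open>Existence of the parameters by the intermediate value theorem\<close>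

lemma twist_parameters_exist:
  fixes a b T :: real
  assumes ab: "0 < a" "a < b" and T: "pi / 2 \<le> T"
  obtains s k where "0 < s" "a < k" "k < b"
    "((b\<^sup>2 - k\<^sup>2) / (b\<^sup>2 + k\<^sup>2))\<^sup>2 * (b\<^sup>2 + a\<^sup>2 * s\<^sup>2) = b\<^sup>2 - a\<^sup>2"
    "s * ln (k / a) + arctan (s * ((b\<^sup>2 - k\<^sup>2) / (b\<^sup>2 + k\<^sup>2))) = T"
proof -
  \<comment> \<open>The boundary equation is solved for \<open>u\<close> at given \<open>s\<close>,
    and \<open>k\<close> inverts the relation between \<open>k\<close> and \<open>u\<close> recorded
    in \<open>k_u\<close>; \<open>F\<close> is the twist angle along this curve.\<close>
  define u where "u = (\<lambda>s. sqrt ((b\<^sup>2 - a\<^sup>2) / (b\<^sup>2 + a\<^sup>2 * s\<^sup>2)))"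
  define k where "k = (\<lambda>s. b * sqrt ((1 - u s) / (1 + u s)))"
  define F where "F = (\<lambda>s. s * ln (k s / a) + arctan (s * u s))"
  have b: "0 < b" using ab by simp
  have pos: "b\<^sup>2 + a\<^sup>2 * s\<^sup>2 > 0" "b\<^sup>2 - a\<^sup>2 > 0" for s
    using ab by (auto intro!: add_pos_nonneg simp: power_strict_mono)
  have u_pos: "0 < u s" for s
    unfolding u_def using pos by simp
  have u_lt: "u s < 1" for s
  proof -
    have "b\<^sup>2 - a\<^sup>2 < b\<^sup>2 + a\<^sup>2 * s\<^sup>2"
      using zero_less_power[OF ab(1), of 2] mult_nonneg_nonneg[OF zero_le_power2[of a] zero_le_power2[of s]]
      by linarith
    then show ?thesis
      unfolding u_def using pos(1)[of s] by (simp add: pos_divide_less_eq)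
  qed
  have k_pos: "0 < k s" for s
    unfolding k_def using u_pos[of s] u_lt[of s] b by simp
  have k_lt: "k s < b" for s
    unfolding k_def using u_pos[of s] u_lt[of s] b by (simp add: pos_divide_less_eq)
  have k_u: "(b\<^sup>2 - (k s)\<^sup>2) / (b\<^sup>2 + (k s)\<^sup>2) = u s" for s
  proof -
    have "(k s)\<^sup>2 = b\<^sup>2 * ((1 - u s) / (1 + u s))"
      unfolding k_def using u_pos[of s] u_lt[of s] by (simp add: power_mult_distrib)
    moreover have "b\<^sup>2 - b\<^sup>2 * ((1 - u s) / (1 + u s)) = 2 * b\<^sup>2 * u s / (1 + u s)"
      "b\<^sup>2 + b\<^sup>2 * ((1 - u s) / (1 + u s)) = 2 * b\<^sup>2 / (1 + u s)"
      using u_pos[of s] by (simp_all add: field_simps)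
    ultimately show ?thesis
      using u_pos[of s] b by simp
  qed
  have eq: "(u s)\<^sup>2 * (b\<^sup>2 + a\<^sup>2 * s\<^sup>2) = b\<^sup>2 - a\<^sup>2" for s
    unfolding u_def using pos(1)[of s] pos(2) by simp
  have nz: "b\<^sup>2 + a\<^sup>2 * s\<^sup>2 \<noteq> 0" "1 + u s \<noteq> 0" "k s \<noteq> 0" "a \<noteq> 0" for s
    using pos(1)[of s] u_pos[of s] k_pos[of s] ab by linarith+
  have cont_u: "continuous_on A u" for A
    unfolding u_def by (intro continuous_intros ballI nz)
  have cont_k: "continuous_on A k" for A
    unfolding k_def by (intro continuous_intros cont_u ballI nz)
  have cont_F: "continuous_on A F" for A
    unfolding F_def by (intro continuous_intros cont_u cont_k ballI nz) (simp add: nz)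
  \<comment> \<open>As \<open>u\<close> tends to 0, \<open>k\<close> tends to \<open>b\<close>, so
    \<open>ln (k s / a)\<close> has the positive limit \<open>ln (b / a)\<close> and its product
    with \<open>s\<close> diverges.\<close>
  have "(u \<longlongrightarrow> 0) at_top"
  proof -
    have "LIM s at_top. b\<^sup>2 + a\<^sup>2 * s\<^sup>2 :> at_top"
      using ab
      by (intro filterlim_tendsto_add_at_top[OF tendsto_const]
          filterlim_tendsto_pos_mult_at_top[OF tendsto_const] filterlim_pow_at_top filterlim_ident) auto
    then have "((\<lambda>s. (b\<^sup>2 - a\<^sup>2) / (b\<^sup>2 + a\<^sup>2 * s\<^sup>2)) \<longlongrightarrow> 0) at_top"
      by (rule real_tendsto_divide_at_top[OF tendsto_const])
    from tendsto_real_sqrt[OF this] show ?thesis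
      unfolding u_def by simp
  qed
  then have "((\<lambda>s. ln (k s / a)) \<longlongrightarrow> ln (b * sqrt ((1 - 0) / (1 + 0)) / a)) at_top"
    unfolding k_def using ab by (intro tendsto_intros) auto
  then have "LIM s at_top. ln (k s / a) * s :> at_top"
    by (rule filterlim_tendsto_pos_mult_at_top) (use ab in \<open>auto simp: filterlim_ident\<close>)
  then have "\<forall>\<^sub>F s in at_top. T \<le> ln (k s / a) * s"
    unfolding filterlim_at_top by blast
  then have "\<forall>\<^sub>F s in at_top. 0 \<le> s \<and> T \<le> ln (k s / a) * s"
    by (intro eventually_conj eventually_ge_at_top)
  then obtain S where S: "0 \<le> S" "T \<le> ln (k S / a) * S"
    by (auto simp: eventually_at_top_linorder)
  have "0 \<le> arctan (S * u S)"
    using S u_pos[of S] by (simp add: zero_le_arctan_iff)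
  then have "T \<le> F S"
    unfolding F_def using S(2) mult.commute[of S "ln (k S / a)"] by linarith
  moreover have "0 \<le> T"
    using T pi_gt_zero by linarith
  then have "F 0 \<le> T"
    by (simp add: F_def)
  ultimately obtain s where s: "0 \<le> s" "F s = T"
    using IVT'[OF _ _ S(1) cont_F, of T] by auto
  \<comment> \<open>The arctangent stays below \<open>pi / 2 \<le> T\<close>, so the logarithmic
    term must supply the rest; this excludes \<open>s = 0\<close> and puts \<open>k s\<close> above
    \<open>a\<close>.\<close>
  have s_ln: "0 < s * ln (k s / a)"
    using s T arctan_ubound[of "s * u s"] unfolding F_def by linarith
  with s have "0 < s"
    by (cases "s = 0") auto
  with s_ln have "0 < ln (k s / a)"
    by (simp add: zero_less_mult_iff)
  then have "a < k s"
    using ab k_pos[of s] by simp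
  with \<open>0 < s\<close> k_lt eq s show ?thesis
    by (intro that[of s "k s"]) (auto simp: k_u F_def)
qed

text \<open>The \<open>k\<close> found lies strictly above \<open>a\<close>, while the competitors
  \<open>k'\<close> may equal \<open>a\<close>; uniqueness thus holds on the whole half-open
  interval.\<close>

theorem theorem4:
  fixes a b :: real and N :: int
  assumes "0 < a" and "a < b" and "N \<ge> 1"
  shows "\<exists>\<omega> k. 0 < \<omega> \<and> k \<in> {a<..<b} \<and>
           twist_solution a b N \<omega> (rho_profile a \<omega> k) \<and>
           (\<forall>\<omega>' k'. 0 < \<omega>' \<and> k' \<in> {a..<b} \<and> twist_solution a b N \<omega>' (rho_profile a \<omega>' k')
              \<longrightarrow> \<omega>' = \<omega> \<and> k' = k) \<and>
           angular_map a b \<omega> (rho_profile a \<omega> k) (psi_profile a \<omega> k) \<and>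
           (\<forall>\<psi>. angular_map a b \<omega> (rho_profile a \<omega> k) \<psi>
              \<longrightarrow> (\<forall>r\<in>{a..b}. \<psi> r = psi_profile a \<omega> k r))"
proof -
  have "pi * 1 \<le> pi * real_of_int N"
    using assms(3) by (intro mult_left_mono) auto
  then have "pi / 2 \<le> 2 * pi * real_of_int N"
    using pi_gt_zero by linarith
  from twist_parameters_exist[OF assms(1,2) this]
  obtain s k where s: "0 < s" and k: "a < k" "k < b"
    and eq: "((b\<^sup>2 - k\<^sup>2) / (b\<^sup>2 + k\<^sup>2))\<^sup>2 * (b\<^sup>2 + a\<^sup>2 * s\<^sup>2) = b\<^sup>2 - a\<^sup>2"
    and angle: "s * ln (k / a) + arctan (s * ((b\<^sup>2 - k\<^sup>2) / (b\<^sup>2 + k\<^sup>2))) = 2 * pi * N"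
    by blast
  have unique: "\<omega>' = a\<^sup>2 * s \<and> k' = k"
    if "0 < \<omega>'" "k' \<in> {a..<b}" "twist_solution a b N \<omega>' (rho_profile a \<omega>' k')" for \<omega>' k'
  proof -
    \<comment> \<open>Every positive \<omega>' has the form \<open>a\<^sup>2 * s'\<close>, so the
      scalar criterion applies to any competitor.\<close>
    define s' where "s' = \<omega>' / a\<^sup>2"
    have s': "0 < s'" "\<omega>' = a\<^sup>2 * s'"
      using that(1) assms(1) by (simp_all add: s'_def)
    have k': "a \<le> k'" "k' < b"
      using that(2) by auto
    have "s = s' \<and> k = k'"
      using that(3) unfolding s'(2) twist_solution_rho_profile_iff[OF assms(1) k' s'(1)]
      by (intro twist_parameters_unique[OF assms(1,2) less_imp_le[OF k(1)] k(2) k' s s'(1) eq _ angle])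
         auto
    then show ?thesis
      using s'(2) by simp
  qed
  have sol: "twist_solution a b N (a\<^sup>2 * s) (rho_profile a (a\<^sup>2 * s) k)"
    using twist_solution_rho_profile_iff[of a k b s N] assms k s eq angle by simp
  have ang: "angular_map a b (a\<^sup>2 * s) (rho_profile a (a\<^sup>2 * s) k) (psi_profile a (a\<^sup>2 * s) k)"
    using assms k s by (intro angular_map_psi_profile) auto
  show ?thesis
  proof (rule exI[of _ "a\<^sup>2 * s"], rule exI[of _ k], intro conjI)
    show "\<forall>\<omega>' k'. 0 < \<omega>' \<and> k' \<in> {a..<b} \<and> twist_solution a b N \<omega>' (rho_profile a \<omega>' k')
        \<longrightarrow> \<omega>' = a\<^sup>2 * s \<and> k' = k"
      using unique by blast
    show "\<forall>\<psi>. angular_map a b (a\<^sup>2 * s) (rho_profile a (a\<^sup>2 * s) k) \<psi>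
        \<longrightarrow> (\<forall>r\<in>{a..b}. \<psi> r = psi_profile a (a\<^sup>2 * s) k r)"
      using angular_map_unique[OF assms(2) _ ang] by blast
    show "0 < a\<^sup>2 * s" "k \<in> {a<..<b}"
      using assms(1) s k by simp_all
  qed (fact sol ang)+
qed

end
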